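(* Let $s\ge 39$ and let $S\subseteq V_d$ be the vertex disjoint union of $s$ cliques $K_1,\dots,K_s$, where $K_i$ has weight $a_i$ and order $a_i+t_i$, the weights $a_1,\dots,a_s$ are pairwise distinct, and $t_i\ge 2$ for each $i$. Then $S$ is not $2$-Ramsey.
   Context: For $d\ge1$, $[d]=\{1,\dots,d\}$ and $V_d=2^{[d]}$ (the set of all subsets of $[d]$) is the vertex set of the $d$-dimensional hypercube $Q_d$; two sets are adjacent iff their symmetric difference has exactly one element. For $1\le d\le n$, an embedding of $Q_d$ into $Q_n$ is an injective map $\psi:V_d\to V_n$ sending adjacent pairs to adjacent pairs. For $F\subseteq V_d$ and $T\subseteq V_n$, $T$ contains a copy of $F$ if some embedding $\psi:V_d\to V_n$ satisfies $\psi(F)\subseteq T$. A $t$-coloring of $Q_n$ is a map $c:V_n\to[t]$; it contains a monochromatic copy of $F$ if some color class $c^{-1}(i)$ contains a copy of $F$. A set $F\subseteq V_d$ is $t$-Ramsey if there is $n_0$ such that for all $n\ge n_0$ every $t$-coloring of $Q_n$ contains a monochromatic copy of $F$. A clique of weight $a$ and order $k$ is a family $K^{(a)}$ consisting of all $a$-element subsets of a set $K$ with $|K|=k$; $K$ is called its vertex set. A union of cliques is vertex disjoint if the vertex sets of distinct cliques are pairwise disjoint. *)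

theory Defs
  imports "HOL-Library.FuncSet" "HOL-Library.Disjoint_Sets" "HOL-Library.Ramsey"
begin

definition cube :: "nat \<Rightarrow> nat set set" where
  "cube d = Pow {1..d}"

definition cube_adj :: "nat set \<Rightarrow> nat set \<Rightarrow> bool" where
  "cube_adj A B \<longleftrightarrow> card (sym_diff A B) = 1"

text \<open>Injectivity forces \<open>d \<le> n\<close>, so this bound is not part of the definition.\<close>

definition cube_embedding :: "nat \<Rightarrow> nat \<Rightarrow> (nat set \<Rightarrow> nat set) \<Rightarrow> bool" where
  "cube_embedding d n \<psi> \<longleftrightarrow>
     \<psi> \<in> cube d \<rightarrow> cube n \<and> inj_on \<psi> (cube d) \<and>
     (\<forall>A\<in>cube d. \<forall>B\<in>cube d. cube_adj A B \<longrightarrow> cube_adj (\<psi> A) (\<psi> B))"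

definition contains_copy :: "nat \<Rightarrow> nat \<Rightarrow> nat set set \<Rightarrow> nat set set \<Rightarrow> bool" where
  "contains_copy d n F T \<longleftrightarrow> (\<exists>\<psi>. cube_embedding d n \<psi> \<and> \<psi> ` F \<subseteq> T)"

definition cube_coloring :: "nat \<Rightarrow> nat \<Rightarrow> (nat set \<Rightarrow> nat) \<Rightarrow> bool" where
  "cube_coloring t n c \<longleftrightarrow> c \<in> cube n \<rightarrow> {1..t}"

definition has_mono_copy :: "nat \<Rightarrow> nat \<Rightarrow> nat \<Rightarrow> nat set set \<Rightarrow> (nat set \<Rightarrow> nat) \<Rightarrow> bool" where
  "has_mono_copy t d n F c \<longleftrightarrow> (\<exists>i\<in>{1..t}. contains_copy d n F {X \<in> cube n. c X = i})"

definition cube_Ramsey :: "nat \<Rightarrow> nat \<Rightarrow> nat set set \<Rightarrow> bool" where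
  "cube_Ramsey t d F \<longleftrightarrow>
     (\<exists>n0. \<forall>n\<ge>n0. \<forall>c. cube_coloring t n c \<longrightarrow> has_mono_copy t d n F c)"

text \<open>
  The vertex set \<open>K\<close> is an argument because the family does not determine it when the
  weight is \<open>0\<close>.
\<close>

definition weighted_clique :: "nat \<Rightarrow> nat \<Rightarrow> nat set \<Rightarrow> nat set set \<Rightarrow> bool" where
  "weighted_clique a k K C \<longleftrightarrow> finite K \<and> card K = k \<and> C = nsets K a"

end

theory Submission
  imports Defs Complex_Main
begin

text \<open>
  Colour a vertex \<open>X\<close> by \<open>f |X|\<close> for a suitable two-colouring \<open>f\<close> of the integers.
  An embedding has the form \<open>X \<mapsto> A \<triangle> \<sigma>(X)\<close>; put \<open>m = |A|\<close>. As \<open>t\<^sub>i \<ge> 2\<close>, the sizes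
  occurring in the image of \<open>K\<^sub>i\<close> include \<open>m + a\<^sub>i\<close>, or \<open>m - a\<^sub>i\<close>, or three numbers
  \<open>x, x + 2, x + 4\<close>. So it suffices that \<open>f\<close> is not constant on any \<open>x, x + 2, x + 4\<close> and that
  for every \<open>m\<close> and every colour some \<open>i\<close> has both \<open>f (m + a\<^sub>i)\<close> and \<open>f (m - a\<^sub>i)\<close> of that colour.
  Pair up \<open>x\<close> and \<open>x + 2\<close> for \<open>x \<equiv> 0, 1 (mod 4)\<close> and colour each pair with two opposite
  colours, independently at random; this settles the first condition. For fixed \<open>m\<close> and
  colour, two of the events \<open>f (m + a\<^sub>i) = f (m - a\<^sub>i) = c\<close> are either independent or mutually
  exclusive, so none of them holds with probability at most \<open>(3/4)\<^sup>3\<^sup>8\<close> (the weight \<open>1\<close> is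
  discarded, as \<open>m - 1\<close> and \<open>m + 1\<close> may form a pair). Each \<open>m\<close> has at most \<open>7 \<cdot> 38\<^sup>2\<close>
  neighbours, so the Local Lemma gives the second condition.
\<close>

section \<open>Counting subsets and the Local Lemma\<close>

lemma card_Pow_split:
  fixes U V :: "'b set"
  assumes "finite U" "V \<subseteq> U"
    and P: "\<And>w. P (w \<inter> V) = P w" and Q: "\<And>w. Q (w - V) = Q w"
  shows "card {w \<in> Pow U. P w \<and> Q w} = card {w \<in> Pow V. P w} * card {w \<in> Pow (U - V). Q w}"
proof -
  have "bij_betw (\<lambda>w. (w \<inter> V, w - V)) {w \<in> Pow U. P w \<and> Q w}
      ({w \<in> Pow V. P w} \<times> {w \<in> Pow (U - V). Q w})"
  proof (rule bij_betw_byWitness[where f' = "\<lambda>(x, y). x \<union> y"])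
    show "(\<lambda>(x, y). x \<union> y) ` ({w \<in> Pow V. P w} \<times> {w \<in> Pow (U - V). Q w})
        \<subseteq> {w \<in> Pow U. P w \<and> Q w}"
    proof clarsimp
      fix x y assume xy: "x \<subseteq> V" "P x" "y \<subseteq> U - V" "Q y"
      then have "(x \<union> y) \<inter> V = x" "(x \<union> y) - V = y" by auto
      with xy P[of "x \<union> y"] Q[of "x \<union> y"] assms(2)
      show "x \<subseteq> U \<and> y \<subseteq> U \<and> P (x \<union> y) \<and> Q (x \<union> y)" by auto
    qed
  qed (use P Q in auto)
  then show ?thesis
    unfolding card_cartesian_product[symmetric] by (rule bij_betw_same_card)
qed

text \<open>Independence of two events for a uniformly random \<open>w\<close>, one decided by the
  part of \<open>w\<close> in \<open>V\<close>, the other by the rest; the product rule is cleared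
  of denominators.\<close>

lemma card_Pow_indep:
  fixes U V :: "'b set"
  assumes U: "finite U" "V \<subseteq> U"
    and P: "\<And>w. P (w \<inter> V) = P w" and Q: "\<And>w. Q (w - V) = Q w"
  shows "real (card {w \<in> Pow U. P w \<and> Q w}) * 2 ^ card U
    = real (card {w \<in> Pow U. P w}) * real (card {w \<in> Pow U. Q w})"
proof -
  have V: "finite V" using U finite_subset by blast
  have "card {w \<in> Pow U. P w} = card {w \<in> Pow V. P w} * 2 ^ card (U - V)"
    using card_Pow_split[OF U, of P "\<lambda>_. True"] P U by (simp flip: Pow_def add: card_Pow)
  moreover have "card {w \<in> Pow U. Q w} = 2 ^ card V * card {w \<in> Pow (U - V). Q w}"
    using card_Pow_split[OF U, of "\<lambda>_. True" Q] Q V by (simp flip: Pow_def add: card_Pow)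
  moreover have "card U = card V + card (U - V)"
    using U V by (metis card_Diff_subset card_mono le_add_diff_inverse)
  ultimately show ?thesis
    using card_Pow_split[OF U, of P Q] P Q by (simp add: power_add)
qed

lemma card_Pow_mem:
  assumes U: "finite U" "x \<in> U"
  shows "real (card {w \<in> Pow U. (x \<in> w) = p}) = 2 ^ card U / 2"
proof -
  have "bij_betw (\<lambda>w. sym_diff w {x}) {w \<in> Pow U. (x \<in> w) = p} {w \<in> Pow U. (x \<in> w) = (\<not> p)}"
    by (rule bij_betw_byWitness[where f' = "\<lambda>w. sym_diff w {x}"]) (use U in auto)
  then have eq: "card {w \<in> Pow U. (x \<in> w) = (\<not> p)} = card {w \<in> Pow U. (x \<in> w) = p}"
    by (simp add: bij_betw_same_card)
  have "card ({w \<in> Pow U. (x \<in> w) = p} \<union> {w \<in> Pow U. (x \<in> w) = (\<not> p)})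
      = card {w \<in> Pow U. (x \<in> w) = p} + card {w \<in> Pow U. (x \<in> w) = (\<not> p)}"
    using U by (intro card_Un_disjoint) auto
  moreover have "{w \<in> Pow U. (x \<in> w) = p} \<union> {w \<in> Pow U. (x \<in> w) = (\<not> p)} = Pow U" by auto
  ultimately have "card (Pow U) = card {w \<in> Pow U. (x \<in> w) = p} + card {w \<in> Pow U. (x \<in> w) = (\<not> p)}"
    by simp
  then have "(2::nat) ^ card U = 2 * card {w \<in> Pow U. (x \<in> w) = p}"
    using eq U by (simp add: card_Pow)
  from arg_cong[OF this, of real]
  have "(2::real) ^ card U = 2 * real (card {w \<in> Pow U. (x \<in> w) = p})" by simp
  then show ?thesis by simp
qed

lemma card_Pow_mem2:
  assumes U: "finite U" "x \<in> U" "y \<in> U" "x \<noteq> y"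
  shows "real (card {w \<in> Pow U. (x \<in> w) = p \<and> (y \<in> w) = q}) = 2 ^ card U / 4"
proof -
  have "real (card {w \<in> Pow U. (x \<in> w) = p \<and> (y \<in> w) = q}) * 2 ^ card U
    = real (card {w \<in> Pow U. (x \<in> w) = p}) * real (card {w \<in> Pow U. (y \<in> w) = q})"
    by (rule card_Pow_indep[of U "{x}"]) (use U in auto)
  also have "\<dots> = (2 ^ card U / 2) * (2 ^ card U / 2)"
    by (simp only: card_Pow_mem[OF U(1,2)] card_Pow_mem[OF U(1,3)])
  finally show ?thesis by (simp add: field_simps)
qed

text \<open>Symmetric Lovasz Local Lemma for a uniformly random subset \<open>w\<close>: events with
  disjoint \<open>V\<close> are independent. The count bounded by \<open>D\<close> includes
  \<open>i\<close> itself whenever \<open>V i\<close> is nonempty.\<close>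

lemma local_lemma_Pow:
  fixes U :: "'b set" and T :: "'i set" and p \<mu> :: real
  assumes U: "finite U" and T: "finite T"
    and VU: "\<And>i. i \<in> T \<Longrightarrow> V i \<subseteq> U"
    and dep: "\<And>i w. i \<in> T \<Longrightarrow> Bad i (w \<inter> V i) = Bad i w"
    and prob: "\<And>i. i \<in> T \<Longrightarrow> real (card {w \<in> Pow U. Bad i w}) \<le> p * 2 ^ card U"
    and deg: "\<And>i. i \<in> T \<Longrightarrow> card {j \<in> T. V j \<inter> V i \<noteq> {}} \<le> D"
    and mu: "0 \<le> \<mu>" "\<mu> < 1" "p \<le> \<mu> * (1 - \<mu>) ^ D"
  shows "\<exists>w \<subseteq> U. \<forall>i\<in>T. \<not> Bad i w"
proof -
  define N where "N S = real (card {w \<in> Pow U. \<forall>i\<in>S. \<not> Bad i w})" for S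
  have N_nonneg: "N S \<ge> 0" for S by (simp add: N_def)
  \<comment> \<open>Given that no event of \<open>S\<close> occurs, \<open>Bad i\<close> fails with
    conditional probability at least \<open>1 - \<mu>\<close>; multiplied out because
    \<open>N S\<close> is not yet known to be positive.\<close>
  have step: "(1 - \<mu>) * N S \<le> N (insert i S)" if "S \<subseteq> T" "i \<in> T" "i \<notin> S" for S i
    using that
  proof (induction "card S" arbitrary: S i rule: less_induct)
    case less
    have fS: "finite S" using less.prems T finite_subset by blast
    define S1 S2 where "S1 = {j \<in> S. V j \<inter> V i \<noteq> {}}" and "S2 = {j \<in> S. V j \<inter> V i = {}}"
    have S: "S = S1 \<union> S2" "S1 \<inter> S2 = {}" by (auto simp: S1_def S2_def)
    have fS12: "finite S1" "finite S2" using fS S by auto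
    have "card S1 \<le> card {j \<in> T. V j \<inter> V i \<noteq> {}}"
      using less.prems T by (intro card_mono) (auto simp: S1_def)
    then have S1D: "card S1 \<le> D" using deg less.prems by force
    \<comment> \<open>The events of \<open>S1\<close> are put back one at a time. Each intermediate
      set misses an element of \<open>S\<close>, so the induction hypothesis applies and costs one
      factor \<open>1 - \<mu>\<close>.\<close>
    have grow: "(1 - \<mu>) ^ card R * N S2 \<le> N (S2 \<union> R)" if "R \<subseteq> S1" for R
      using finite_subset[OF that fS12(1)] that
    proof (induction R)
      case empty show ?case by simp
    next
      case (insert x R)
      have "S2 \<union> R \<subset> S" using insert S by auto
      then have "card (S2 \<union> R) < card S" using fS by (simp add: psubset_card_mono)
      then have "(1 - \<mu>) * N (S2 \<union> R) \<le> N (insert x (S2 \<union> R))"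
        using insert S less.prems by (intro less.hyps) auto
      moreover have "(1 - \<mu>) * ((1 - \<mu>) ^ card R * N S2) \<le> (1 - \<mu>) * N (S2 \<union> R)"
        using insert mu by (intro mult_left_mono) auto
      ultimately show ?case using insert by simp
    qed
    \<comment> \<open>Forgetting \<open>S1\<close> only enlarges the count and leaves conditions
      independent of \<open>Bad i\<close>.\<close>
    let ?B = "{w \<in> Pow U. Bad i w \<and> (\<forall>j\<in>S2. \<not> Bad j w)}"
    have S2dep: "(\<forall>j\<in>S2. \<not> Bad j (w - V i)) = (\<forall>j\<in>S2. \<not> Bad j w)" for w
    proof -
      have "Bad j (w - V i) = Bad j w" if "j \<in> S2" for j
      proof -
        have "j \<in> T" "(w - V i) \<inter> V j = w \<inter> V j" using that less.prems by (auto simp: S2_def)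
        then show ?thesis using dep[of j "w - V i"] dep[of j w] by simp
      qed
      then show ?thesis by blast
    qed
    have "real (card ?B) * 2 ^ card U = real (card {w \<in> Pow U. Bad i w}) * N S2"
      unfolding N_def using less.prems VU dep S2dep
      by (intro card_Pow_indep[of U "V i"] U) auto
    also have "\<dots> \<le> p * 2 ^ card U * N S2"
      using prob less.prems N_nonneg by (intro mult_right_mono) auto
    finally have "real (card ?B) \<le> p * N S2" by (simp add: field_simps)
    also have "\<dots> \<le> \<mu> * (1 - \<mu>) ^ D * N S2" using mu N_nonneg by (intro mult_right_mono) auto
    also have "\<dots> \<le> \<mu> * (1 - \<mu>) ^ card S1 * N S2"
      using mu S1D N_nonneg by (intro mult_right_mono mult_left_mono power_decreasing) auto
    also have "\<dots> \<le> \<mu> * N S"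
      using grow[of S1] S mu by (simp add: mult.assoc mult_left_mono Un_commute)
    finally have B: "real (card ?B) \<le> \<mu> * N S" .
    have "card {w \<in> Pow U. \<forall>j\<in>S. \<not> Bad j w}
        \<le> card ({w \<in> Pow U. \<forall>j\<in>insert i S. \<not> Bad j w} \<union> ?B)"
      using U S by (intro card_mono) auto
    also have "\<dots> \<le> card {w \<in> Pow U. \<forall>j\<in>insert i S. \<not> Bad j w} + card ?B"
      by (rule card_Un_le)
    finally have "N S \<le> N (insert i S) + real (card ?B)" unfolding N_def by linarith
    with B show ?case by (simp add: algebra_simps)
  qed
  have "(1 - \<mu>) ^ card S * N {} \<le> N S" if "S \<subseteq> T" for S
    using finite_subset[OF that T] that
  proof (induction S)
    case (insert x S)
    have "(1 - \<mu>) * ((1 - \<mu>) ^ card S * N {}) \<le> (1 - \<mu>) * N S"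
      using insert mu by (intro mult_left_mono) auto
    also have "\<dots> \<le> N (insert x S)" using insert step by auto
    finally show ?case using insert by simp
  qed simp
  from this[of T] have "(1 - \<mu>) ^ card T * N {} \<le> N T" by simp
  moreover have "N {} > 0" using U by (simp add: N_def card_Pow flip: Pow_def)
  ultimately have "N T > 0" using mu by (smt (verit) mult_pos_pos zero_less_power)
  then have "{w \<in> Pow U. \<forall>i\<in>T. \<not> Bad i w} \<noteq> {}"
    unfolding N_def by (metis card.empty of_nat_0 less_irrefl)
  then show ?thesis by auto
qed

section \<open>Colouring the integers\<close>

definition pair_base :: "int \<Rightarrow> int" where
  "pair_base x = (if x mod 4 < 2 then x else x - 2)"

text \<open>\<open>w\<close> collects the smaller elements of pairs that are coloured
  \<open>True\<close>, so a random \<open>w\<close> tosses one fair coin per pair.\<close>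

definition pair_colour :: "int set \<Rightarrow> int \<Rightarrow> bool" where
  "pair_colour w x \<longleftrightarrow> (pair_base x \<in> w) = (x mod 4 < 2)"

definition pair_shift :: "int \<Rightarrow> int" where
  "pair_shift x = (if x mod 4 < 2 then 2 else -2)"

definition pair_support :: "nat set \<Rightarrow> int \<Rightarrow> int set" where
  "pair_support J m = (\<Union>a\<in>J. {pair_base (m + int a), pair_base (m - int a)})"

definition both_coloured :: "bool \<Rightarrow> int \<Rightarrow> int set \<Rightarrow> nat \<Rightarrow> bool" where
  "both_coloured c m w a \<longleftrightarrow> pair_colour w (m + int a) = c \<and> pair_colour w (m - int a) = c"

lemma pair_base_eqD: "pair_base x = pair_base y \<Longrightarrow> y = x \<or> y = x + pair_shift x"
  unfolding pair_base_def pair_shift_def by (simp split: if_splits; presburger)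

lemma pair_colour_opposite:
  "pair_base x = pair_base y \<Longrightarrow> x \<noteq> y \<Longrightarrow> pair_colour w x \<noteq> pair_colour w y"
  unfolding pair_base_def pair_colour_def by (simp split: if_splits; presburger)

lemma pair_colour_triple:
  "\<not> (pair_colour w x = c \<and> pair_colour w (x + 2) = c \<and> pair_colour w (x + 4) = c)"
proof (cases "x mod 4 < 2")
  case True
  then have "pair_base x = pair_base (x + 2)" unfolding pair_base_def by (simp; presburger)
  then show ?thesis using pair_colour_opposite[of x "x + 2" w] by auto
next
  case False
  then have "pair_base (x + 2) = pair_base (x + 4)" unfolding pair_base_def by (simp; presburger)
  then show ?thesis using pair_colour_opposite[of "x + 2" "x + 4" w] by auto
qed

text \<open>Distinct elements of a pair differ by \<open>2\<close>, while these two integers differ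
  by \<open>2 * a\<close>.\<close>

lemma pair_base_symmetric: "pair_base (m + int a) = pair_base (m - int a) \<Longrightarrow> a = 0 \<or> a = 1"
  by (drule pair_base_eqD) (auto simp: pair_shift_def split: if_splits)

section \<open>Probability of failure at a fixed centre \<open>m\<close>\<close>

lemma both_coloured_cong:
  assumes "\<And>x. x \<in> {pair_base (m + int a), pair_base (m - int a)} \<Longrightarrow> (x \<in> w) = (x \<in> w')"
  shows "both_coloured c m w a = both_coloured c m w' a"
  using assms by (simp add: both_coloured_def pair_colour_def)

text \<open>For \<open>a = 0\<close> a single coin decides, with probability \<open>1 / 2\<close>;
  otherwise two distinct coins give \<open>1 / 4\<close>.\<close>

lemma card_both_coloured:
  assumes U: "finite U" "pair_base (m + int a) \<in> U" "pair_base (m - int a) \<in> U" and "a \<noteq> 1"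
  shows "real (card {w \<in> Pow U. both_coloured c m w a}) \<ge> 2 ^ card U / 4"
proof -
  let ?x = "m + int a" and ?y = "m - int a"
  have colour: "(pair_colour w x = c) = ((pair_base x \<in> w) = (c = (x mod 4 < 2)))" for w x
    by (auto simp: pair_colour_def)
  show ?thesis
  proof (cases "a = 0")
    case True
    then have "{w \<in> Pow U. both_coloured c m w a}
        = {w \<in> Pow U. (pair_base ?x \<in> w) = (c = (?x mod 4 < 2))}"
      by (simp add: both_coloured_def colour)
    then show ?thesis by (simp only: card_Pow_mem[OF U(1,2)]) simp
  next
    case False
    then have "pair_base ?x \<noteq> pair_base ?y" using pair_base_symmetric assms by blast
    then show ?thesis unfolding both_coloured_def colour using card_Pow_mem2[OF U] by simp
  qed
qed

text \<open>Each weight contributes a factor of at most \<open>3 / 4\<close>: even if none of the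
  earlier events occurs, the event of a new weight has probability at least \<open>1 / 4\<close>,
  since it excludes the earlier events that share a coin with it and is independent of the
  others.\<close>

lemma card_none_both_coloured:
  assumes U: "finite U" and J: "finite J" "1 \<notin> J" "pair_support J m \<subseteq> U"
  shows "real (card {w \<in> Pow U. \<forall>a\<in>J. \<not> both_coloured c m w a}) \<le> (3 / 4) ^ card J * 2 ^ card U"
  using J
proof (induction J)
  case empty
  then show ?case using U by (simp add: card_Pow flip: Pow_def)
next
  case (insert a J)
  let ?V = "{pair_base (m + int a), pair_base (m - int a)}"
  define J' where "J' = {b \<in> J. {pair_base (m + int b), pair_base (m - int b)} \<inter> ?V = {}}"
  have sub: "?V \<subseteq> U" "pair_support J m \<subseteq> U"
    using insert.prems by (auto simp: pair_support_def)
  let ?A = "{w \<in> Pow U. \<forall>b\<in>J. \<not> both_coloured c m w b}"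
  let ?G = "{w \<in> Pow U. both_coloured c m w a \<and> (\<forall>b\<in>J'. \<not> both_coloured c m w b)}"
  \<comment> \<open>Events sharing a pair exclude each other, because they prescribe opposite colours on it.\<close>
  have excl: "\<not> both_coloured c m w b" if a: "both_coloured c m w a" and bJ: "b \<in> J - J'" for w b
  proof
    assume b: "both_coloured c m w b"
    have ab: "a \<noteq> b" using bJ insert.hyps by auto
    have "\<exists>x\<in>{m + int a, m - int a}. \<exists>y\<in>{m + int b, m - int b}. pair_base x = pair_base y"
      using bJ by (auto simp: J'_def)
    then obtain x y where xy: "x \<in> {m + int a, m - int a}" "y \<in> {m + int b, m - int b}"
      "pair_base x = pair_base y"
      by blast
    then have "x \<noteq> y" using ab by auto
    then have "pair_colour w x \<noteq> pair_colour w y" using pair_colour_opposite xy by blast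
    moreover have "pair_colour w x = c" "pair_colour w y = c"
      using a b xy by (auto simp: both_coloured_def)
    ultimately show False by simp
  qed
  have disj: "{w \<in> Pow U. \<forall>b\<in>insert a J. \<not> both_coloured c m w b} \<inter> ?G = {}" by auto
  have split: "{w \<in> Pow U. \<forall>b\<in>insert a J. \<not> both_coloured c m w b} \<union> ?G = ?A"
  proof -
    have "J' \<subseteq> J" by (auto simp: J'_def)
    then show ?thesis using excl by (auto 0 3)
  qed
  have eq: "card ?A = card {w \<in> Pow U. \<forall>b\<in>insert a J. \<not> both_coloured c m w b} + card ?G"
    using card_Un_disjoint[OF _ _ disj] U unfolding split by simp
  \<comment> \<open>Passing from \<open>J\<close> to \<open>J'\<close> weakens the requirement, so
    \<open>?A\<close> lies in the last family on the right, whose condition involves no coin of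
    \<open>?V\<close>.\<close>
  have "(2 ^ card U / 4) * real (card ?A)
      \<le> real (card {w \<in> Pow U. both_coloured c m w a})
        * real (card {w \<in> Pow U. \<forall>b\<in>J'. \<not> both_coloured c m w b})"
    using U sub insert.prems
    by (intro mult_mono card_both_coloured) (auto simp: J'_def intro!: card_mono)
  also have "\<dots> = real (card ?G) * 2 ^ card U"
  proof (rule card_Pow_indep[symmetric, OF U sub(1)])
    show "both_coloured c m (w \<inter> ?V) a = both_coloured c m w a" for w
      by (rule both_coloured_cong) auto
    show "(\<forall>b\<in>J'. \<not> both_coloured c m (w - ?V) b) = (\<forall>b\<in>J'. \<not> both_coloured c m w b)" for w
    proof -
      have "both_coloured c m (w - ?V) b = both_coloured c m w b" if "b \<in> J'" for b
        using that by (intro both_coloured_cong) (auto simp: J'_def)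
      then show ?thesis by blast
    qed
  qed
  finally have "real (card ?A) \<le> 4 * real (card ?G)" by (simp add: field_simps)
  then have "real (card {w \<in> Pow U. \<forall>b\<in>insert a J. \<not> both_coloured c m w b})
      \<le> 3 / 4 * real (card ?A)" using eq by simp
  also have "\<dots> \<le> 3 / 4 * ((3 / 4) ^ card J * 2 ^ card U)"
    using insert sub by (intro mult_left_mono) auto
  finally show ?case using insert by simp
qed

text \<open>A common coin forces \<open>m' + b\<close> or \<open>m' - b\<close> to be
  \<open>m + a\<close>, \<open>m - a\<close> or the partner of one of them, so \<open>a\<close>,
  \<open>b\<close> and the type of coincidence determine \<open>m'\<close>.\<close>

lemma card_pair_support_neighbours:
  assumes "finite J"
  shows "card {m' \<in> T. pair_support J m' \<inter> pair_support J m \<noteq> {}} \<le> 7 * (card J)\<^sup>2"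
proof -
  \<comment> \<open>The coincidences \<open>m + a = m' + b\<close> and \<open>m - b = m' - a\<close> yield the same \<open>m'\<close>,
    whence \<open>7\<close> instead of \<open>8\<close>.\<close>
  define g :: "nat \<Rightarrow> nat \<times> nat \<Rightarrow> int" where
    "g k = (\<lambda>(a, b). [m + a - b, m + a + b, m - a - b,
       m + a + pair_shift (m + a) - b, m + a + pair_shift (m + a) + b,
       m - a + pair_shift (m - a) - b, m - a + pair_shift (m - a) + b] ! k)" for k
  have "{m' \<in> T. pair_support J m' \<inter> pair_support J m \<noteq> {}} \<subseteq> (\<Union>k<7. g k ` (J \<times> J))"
  proof
    fix m' assume "m' \<in> {m' \<in> T. pair_support J m' \<inter> pair_support J m \<noteq> {}}"
    then obtain a b x y where ab: "a \<in> J" "b \<in> J" and x: "x = m + int a \<or> x = m - int a"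
      and y: "y = m' + int b \<or> y = m' - int b" and "pair_base x = pair_base y"
      unfolding pair_support_def by (auto; metis)
    then have xy: "y = x \<or> y = x + pair_shift x" using pair_base_eqD by blast
    have mem: "m' \<in> (\<Union>k<7. g k ` (J \<times> J))" if "m' = g k (a', b')" "k < 7" "a' \<in> J" "b' \<in> J"
      for k a' b' using that by blast
    from x y xy show "m' \<in> (\<Union>k<7. g k ` (J \<times> J))"
    proof (elim disjE, goal_cases)
      case 1 then show ?case using ab by (intro mem[of 0 a b]) (auto simp: g_def)
    next
      case 2 then show ?case using ab by (intro mem[of 3 a b]) (auto simp: g_def)
    next
      case 3 then show ?case using ab by (intro mem[of 1 a b]) (auto simp: g_def)
    next
      case 4 then show ?case using ab by (intro mem[of 4 a b]) (auto simp: g_def)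
    next
      case 5 then show ?case using ab by (intro mem[of 2 a b]) (auto simp: g_def)
    next
      case 6 then show ?case using ab by (intro mem[of 5 a b]) (auto simp: g_def)
    next
      case 7 then show ?case using ab by (intro mem[of 0 b a]) (auto simp: g_def)
    next
      case 8 then show ?case using ab by (intro mem[of 6 a b]) (auto simp: g_def)
    qed
  qed
  then have "card {m' \<in> T. pair_support J m' \<inter> pair_support J m \<noteq> {}}
      \<le> card (\<Union>k<7. g k ` (J \<times> J))"
    using assms by (intro card_mono) auto
  also have "\<dots> \<le> (\<Sum>k<7. card (g k ` (J \<times> J)))" by (rule card_UN_le) simp
  also have "\<dots> \<le> (\<Sum>k<(7::nat). card (J \<times> J))"
    using assms by (intro sum_mono card_image_le) auto
  finally show ?thesis by (simp add: card_cartesian_product power2_eq_square)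
qed

text \<open>The base is the reciprocal of \<open>1 + 1 / n\<close>, whose power is at most
  \<open>exp (1 + 1 / n)\<close>; \<open>275 / 100\<close> is a rational bound slightly above
  e.\<close>

lemma inverse_e_power_bound:
  assumes "n \<ge> 5000"
  shows "100 / 275 \<le> (1 - 1 / real (Suc n)) ^ Suc n"
proof -
  have "(1 + 1 / real n) ^ Suc n \<le> exp (1 / real n) ^ Suc n"
    by (intro power_mono exp_ge_add_one_self) simp
  also have "\<dots> = exp (real (Suc n) * (1 / real n))" by (rule exp_of_nat_mult[symmetric])
  also have "real (Suc n) * (1 / real n) = 1 + 1 / real n" using assms by (simp add: field_simps)
  \<comment> \<open>The quadratic \<open>exp_bound\<close> is too coarse near \<open>1\<close>;
    \<open>64\<close> equal parts make its error small enough.\<close>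
  also have "exp (1 + 1 / real n) = exp ((1 + 1 / real n) / 64) ^ 64"
    by (simp flip: exp_of_nat_mult)
  also have "\<dots> \<le> (10159 / 10 ^ 4) ^ 64"
  proof (intro power_mono)
    have "1 / real n \<le> 1 / 5000" using assms by (intro divide_left_mono) auto
    then have n: "(1 + 1 / real n) / 64 \<le> 1563 / 10 ^ 5" by simp
    then have "exp ((1 + 1 / real n) / 64) \<le> 1 + (1 + 1 / real n) / 64 + ((1 + 1 / real n) / 64)\<^sup>2"
      by (intro exp_bound) auto
    also have "\<dots> \<le> 1 + 1563 / 10 ^ 5 + (1563 / 10 ^ 5)\<^sup>2"
      using n by (intro add_mono power_mono) auto
    also have "\<dots> \<le> 10159 / 10 ^ 4" by (simp add: power_divide)
    finally show "exp ((1 + 1 / real n) / 64) \<le> 10159 / 10 ^ 4" .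
  qed auto
  also have "\<dots> \<le> 275 / 100" by (simp add: power_divide)
  finally have *: "(1 + 1 / real n) ^ Suc n \<le> 275 / 100" .
  have pos: "0 < (1 + 1 / real n) ^ Suc n"
    by (rule zero_less_power) (simp add: add_pos_nonneg)
  have "1 - 1 / real (Suc n) = inverse (1 + 1 / real n)" using assms by (simp add: field_simps)
  then have "(1 - 1 / real (Suc n)) ^ Suc n = inverse ((1 + 1 / real n) ^ Suc n)"
    by (simp only: power_inverse)
  also have "\<dots> \<ge> inverse (275 / 100)" using * pos by (rule le_imp_inverse_le)
  finally show ?thesis by simp
qed

lemma exists_pair_colouring:
  assumes "finite J" "card J \<ge> 38" "1 \<notin> J"
  obtains w where "\<And>m c. m \<in> {0..int n} \<Longrightarrow> \<exists>a\<in>J. both_coloured c m w a"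
proof -
  obtain I where I: "I \<subseteq> J" "card I = 38" "finite I" "1 \<notin> I"
    using assms by (metis obtain_subset_with_card_n subsetD)
  define U where "U = (\<Union>m\<in>{0..int n}. pair_support I m)"
  have U: "finite U" using I by (auto simp: U_def pair_support_def)
  \<comment> \<open>\<open>D = 7 \<cdot> 38\<^sup>2\<close> stays opaque, lest the simplifier evaluate the \<open>D\<close>-th power.\<close>
  obtain D :: nat where D: "D = 10108" by blast
  have "100 / 275 \<le> (1 - 1 / real D) ^ D"
  proof -
    have "Suc (D - 1) = D" "D - 1 \<ge> 5000" using D by auto
    then show ?thesis using inverse_e_power_bound[of "D - 1"] by metis
  qed
  then have "1 / real D * (100 / 275) \<le> 1 / real D * (1 - 1 / real D) ^ D"
    by (rule mult_left_mono) simp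
  \<comment> \<open>The margin is below one percent: \<open>37\<close> weights, or a degree bound
    with \<open>8\<close> in place of \<open>7\<close>, would fail here.\<close>
  moreover have "2 * (3 / 4) ^ 38 \<le> 1 / real D * (100 / 275)"
    unfolding D by (simp add: power_divide)
  ultimately have numeric: "2 * (3 / 4) ^ 38 \<le> 1 / real D * (1 - 1 / real D) ^ D"
    by (rule order_trans[rotated])
  \<comment> \<open>One bad event per \<open>m\<close> covers both colours; the union bound over
    them is the factor \<open>2\<close> in \<open>p\<close>.\<close>
  have "\<exists>w \<subseteq> U. \<forall>m\<in>{0..int n}. \<not> (\<exists>c. \<forall>a\<in>I. \<not> both_coloured c m w a)"
  proof (rule local_lemma_Pow[OF U, where V = "pair_support I" and D = D and \<mu> = "1 / real D"
        and p = "2 * (3 / 4) ^ 38"])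
    fix m assume m: "m \<in> {0..int n}"
    then show sub: "pair_support I m \<subseteq> U" by (auto simp: U_def)
    show "(\<exists>c. \<forall>a\<in>I. \<not> both_coloured c m (w \<inter> pair_support I m) a)
        = (\<exists>c. \<forall>a\<in>I. \<not> both_coloured c m w a)" for w
    proof -
      have "both_coloured c m (w \<inter> pair_support I m) a = both_coloured c m w a" if "a \<in> I" for a c
        using that by (intro both_coloured_cong) (auto simp: pair_support_def)
      then show ?thesis by blast
    qed
    let ?N = "\<lambda>c. {w \<in> Pow U. \<forall>a\<in>I. \<not> both_coloured c m w a}"
    have "{w \<in> Pow U. \<exists>c. \<forall>a\<in>I. \<not> both_coloured c m w a} = ?N True \<union> ?N False"
      by (auto; metis (full_types))
    then have "card {w \<in> Pow U. \<exists>c. \<forall>a\<in>I. \<not> both_coloured c m w a}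
        \<le> card (?N True) + card (?N False)"
      by (simp only: card_Un_le)
    then show "real (card {w \<in> Pow U. \<exists>c. \<forall>a\<in>I. \<not> both_coloured c m w a})
        \<le> 2 * (3 / 4) ^ 38 * 2 ^ card U"
      using card_none_both_coloured[OF U I(3,4) sub, of True]
        card_none_both_coloured[OF U I(3,4) sub, of False] unfolding I(2) by linarith
    show "card {m' \<in> {0..int n}. pair_support I m' \<inter> pair_support I m \<noteq> {}} \<le> D"
      using card_pair_support_neighbours[OF I(3), of "{0..int n}" m] I(2) D by simp
  next
    show "2 * (3 / 4) ^ 38 \<le> 1 / real D * (1 - 1 / real D) ^ D" by (rule numeric)
    show "1 / real D < 1" using D by simp
  qed auto
  then show ?thesis using that I by (meson subsetD)
qed

section \<open>Embeddings of hypercubes\<close>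

lemma sym_diff_cancel: "sym_diff A (sym_diff A B) = B"
  by auto

lemma sym_diff_eq_iff: "sym_diff A B = D \<longleftrightarrow> B = sym_diff A D"
  by (auto simp only: sym_diff_cancel)

lemma cube_adj_iff: "cube_adj A B \<longleftrightarrow> (\<exists>x. B = sym_diff A {x})"
  unfolding cube_adj_def card_1_singleton_iff One_nat_def by (simp only: sym_diff_eq_iff)

lemma sym_diff_insert: "u \<notin> V \<Longrightarrow> sym_diff A (insert u V) = sym_diff (sym_diff A V) {u}"
  by auto

text \<open>Two vertices of the cube at distance two have only two common neighbours: here
  \<open>W\<close> and the vertex opposite to it, reached with \<open>u = x\<close>.\<close>

lemma sym_diff_singletons_cases:
  assumes "sym_diff (sym_diff W {y}) {u} = sym_diff (sym_diff W {x}) {v}" "x \<noteq> y"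
  shows "sym_diff (sym_diff W {y}) {u} = W \<or> u = x"
proof -
  have "u = x \<or> u = y"
  proof (rule ccontr)
    assume "\<not> (u = x \<or> u = y)"
    then have "(x \<in> sym_diff (sym_diff W {y}) {u}) = (x \<in> W)"
      "(y \<in> sym_diff (sym_diff W {y}) {u}) = (y \<notin> W)"
      using assms(2) by auto
    moreover have "(x \<in> sym_diff (sym_diff W {x}) {v}) = ((x \<in> W) = (x = v))"
      "(y \<in> sym_diff (sym_diff W {x}) {v}) = ((y \<notin> W) = (y = v))"
      using assms(2) by auto
    ultimately have "x = v" "y = v" unfolding assms(1) by argo+
    then show False using assms(2) by simp
  qed
  then show ?thesis by auto
qed

text \<open>\<open>\<sigma>\<close> is read off from the singletons. A larger set completes a
  four-cycle whose other three vertices have known images, and injectivity leaves one possible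
  image.\<close>

lemma cube_embedding_sym_diff:
  assumes emb: "cube_embedding d n \<psi>"
  obtains \<sigma> where "inj_on \<sigma> {1..d}" "\<And>X. X \<subseteq> {1..d} \<Longrightarrow> \<psi> X = sym_diff (\<psi> {}) (\<sigma> ` X)"
proof -
  have inj: "\<psi> X = \<psi> Y \<longleftrightarrow> X = Y" if "X \<subseteq> {1..d}" "Y \<subseteq> {1..d}" for X Y
    using emb that inj_on_eq_iff[of \<psi> "cube d" X Y] by (simp add: cube_embedding_def cube_def)
  have adj: "\<exists>u. \<psi> (insert x X) = sym_diff (\<psi> X) {u}"
    if "insert x X \<subseteq> {1..d}" "x \<notin> X" for x X
  proof -
    have "cube_adj X (insert x X)" unfolding cube_adj_iff using that by (intro exI[of _ x]) auto
    then have "cube_adj (\<psi> X) (\<psi> (insert x X))"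
      using emb that by (auto simp: cube_embedding_def cube_def)
    then show ?thesis by (simp add: cube_adj_iff)
  qed
  have "\<forall>x\<in>{1..d}. \<exists>u. \<psi> {x} = sym_diff (\<psi> {}) {u}" using adj[of _ "{}"] by auto
  then obtain \<sigma> where \<sigma>: "\<And>x. x \<in> {1..d} \<Longrightarrow> \<psi> {x} = sym_diff (\<psi> {}) {\<sigma> x}" by metis
  have inj_\<sigma>: "inj_on \<sigma> {1..d}"
  proof (rule inj_onI)
    fix x y assume xy: "x \<in> {1..d}" "y \<in> {1..d}" "\<sigma> x = \<sigma> y"
    then have "\<psi> {x} = \<psi> {y}" using \<sigma> by simp
    then show "x = y" using inj[of "{x}" "{y}"] xy by auto
  qed
  have "\<psi> X = sym_diff (\<psi> {}) (\<sigma> ` X)" if "X \<subseteq> {1..d}" for X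
    using that
  proof (induction "card X" arbitrary: X rule: less_induct)
    case less
    have fX: "finite X" using less.prems finite_subset by blast
    have IH: "\<psi> Y = sym_diff (\<psi> {}) (\<sigma> ` Y)" if "Y \<subset> X" for Y
      using less.hyps[OF psubset_card_mono[OF fX that]] that less.prems
      by (meson psubsetE subset_trans)
    consider "X = {}" | x where "X = {x}" | x y Z where "X = insert x (insert y Z)"
      "x \<noteq> y" "x \<notin> Z" "y \<notin> Z"
    proof (cases "\<exists>x\<in>X. \<exists>y\<in>X. x \<noteq> y")
      case True
      then obtain x y where "x \<in> X" "y \<in> X" "x \<noteq> y" by blast
      then show ?thesis by (intro that(3)[of x y "X - {x, y}"]) auto
    next
      case False
      then show ?thesis using that(1,2) by blast
    qed
    then show ?case
    proof cases
      case 1 then show ?thesis by simp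
    next
      case 2 then show ?thesis using \<sigma> less.prems by simp
    next
      case 3
      have Z: "insert x (insert y Z) \<subseteq> {1..d}" "finite Z" using 3 less.prems fX by auto
      have nin: "\<sigma> x \<notin> \<sigma> ` Z" "\<sigma> y \<notin> \<sigma> ` Z" "\<sigma> x \<noteq> \<sigma> y"
        using inj_on_image_mem_iff[OF inj_\<sigma>, of _ Z] inj_on_eq_iff[OF inj_\<sigma>, of x y] Z(1) 3(2-4)
        by simp_all
      define W where "W = \<psi> Z"
      have W: "W = sym_diff (\<psi> {}) (\<sigma> ` Z)"
        unfolding W_def by (rule IH) (use 3 in auto)
      have "\<psi> (insert x Z) = sym_diff (\<psi> {}) (\<sigma> ` insert x Z)" by (rule IH) (use 3 in auto)
      then have x: "\<psi> (insert x Z) = sym_diff W {\<sigma> x}"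
        by (simp only: image_insert sym_diff_insert[OF nin(1)] W)
      have "\<psi> (insert y Z) = sym_diff (\<psi> {}) (\<sigma> ` insert y Z)" by (rule IH) (use 3 in auto)
      then have y: "\<psi> (insert y Z) = sym_diff W {\<sigma> y}"
        by (simp only: image_insert sym_diff_insert[OF nin(2)] W)
      have "\<exists>u. \<psi> X = sym_diff (\<psi> (insert y Z)) {u}"
        unfolding 3(1) by (rule adj) (use Z 3 in auto)
      then obtain u where u: "\<psi> X = sym_diff (sym_diff W {\<sigma> y}) {u}" unfolding y ..
      have "\<exists>v. \<psi> X = sym_diff (\<psi> (insert x Z)) {v}"
        unfolding 3(1) insert_commute[of x y] by (rule adj) (use Z 3 in auto)
      then obtain v where v: "\<psi> X = sym_diff (sym_diff W {\<sigma> x}) {v}" unfolding x ..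
      have "\<psi> X \<noteq> W" unfolding W_def using inj[of X Z] Z 3 by auto
      then have "u = \<sigma> x"
        using sym_diff_singletons_cases[OF trans[OF u[symmetric] v] nin(3)] unfolding u by argo
      moreover have "\<sigma> x \<notin> \<sigma> ` insert y Z" using nin by simp
      ultimately show ?thesis
        unfolding u unfolding 3(1) image_insert
        by (simp only: sym_diff_insert nin W not_False_eq_True image_insert)
    qed
  qed
  with inj_\<sigma> that show ?thesis by blast
qed

section \<open>Sizes in the image of a clique\<close>

lemma card_sym_diff_image:
  assumes "finite A" "finite X" "inj_on \<sigma> X"
  shows "int (card (sym_diff A (\<sigma> ` X))) = int (card A) + int (card X) - 2 * int (card {x \<in> X. \<sigma> x \<in> A})"
proof -
  have "card {x \<in> X. \<sigma> x \<in> A} = card (\<sigma> ` {x \<in> X. \<sigma> x \<in> A})"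
    using assms by (metis (no_types, lifting) card_image inj_on_subset mem_Collect_eq subsetI)
  also have "\<sigma> ` {x \<in> X. \<sigma> x \<in> A} = A \<inter> \<sigma> ` X" by auto
  finally have int: "card {x \<in> X. \<sigma> x \<in> A} = card (A \<inter> \<sigma> ` X)" .
  have "card (sym_diff A (\<sigma> ` X)) = card (A - \<sigma> ` X) + card (\<sigma> ` X - A)"
    using assms by (intro card_Un_disjoint) auto
  moreover have "card A = card (A \<inter> \<sigma> ` X) + card (A - \<sigma> ` X)"
    using assms by (metis card_Int_Diff add.commute)
  moreover have "card (\<sigma> ` X) = card (A \<inter> \<sigma> ` X) + card (\<sigma> ` X - A)"
    using assms by (metis card_Int_Diff finite_imageI Int_commute)
  moreover have "card (\<sigma> ` X) = card X" using assms by (simp add: card_image)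
  ultimately show ?thesis using int by linarith
qed

lemma obtain_nsets_inter:
  assumes "finite K" "B \<subseteq> K" "j \<le> a" "j \<le> card B" "a - j \<le> card (K - B)"
  obtains X where "X \<in> nsets K a" "card (X \<inter> B) = j"
proof -
  obtain Y where Y: "Y \<subseteq> B" "card Y = j" "finite Y"
    using assms obtain_subset_with_card_n by metis
  obtain Z where Z: "Z \<subseteq> K - B" "card Z = a - j" "finite Z"
    using assms obtain_subset_with_card_n by metis
  have "card (Y \<union> Z) = a" using Y Z assms by (subst card_Un_disjoint) auto
  moreover have "(Y \<union> Z) \<inter> B = Y" using Y Z by auto
  ultimately show ?thesis using that[of "Y \<union> Z"] Y Z assms by (auto simp: nsets_def)
qed

text \<open>With \<open>B\<close> the part of \<open>K\<close> mapped into \<open>A\<close>, a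
  member meeting \<open>B\<close> in \<open>j\<close> points has an image of size
  \<open>card A + a - 2 * j\<close>. If neither \<open>j = 0\<close> nor \<open>j = a\<close> is
  possible, then \<open>t < card B < a\<close>, and the three values of \<open>j\<close> from
  \<open>card B - 2\<close> to \<open>card B\<close> yield a forbidden triple.\<close>

lemma mono_clique_cases:
  fixes f :: "int \<Rightarrow> bool"
  assumes K: "finite K" "card K = a + t" "t \<ge> 2" and A: "finite A" and inj: "inj_on \<sigma> K"
    and mono: "\<And>X. X \<in> nsets K a \<Longrightarrow> f (int (card (sym_diff A (\<sigma> ` X)))) = c"
    and triple: "\<And>x. \<not> (f x = c \<and> f (x + 2) = c \<and> f (x + 4) = c)"
  shows "f (int (card A) + int a) = c \<or> f (int (card A) - int a) = c"
proof -
  define B where "B = {x \<in> K. \<sigma> x \<in> A}"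
  have B: "B \<subseteq> K" "card (K - B) = a + t - card B" "card B \<le> a + t"
    using K card_mono[of K B] by (auto simp: B_def card_Diff_subset)
  have val: "f (int (card A) + int a - 2 * int j) = c"
    if j: "j \<le> a" "j \<le> card B" "a - j \<le> card (K - B)" for j
  proof -
    obtain X where X: "X \<in> nsets K a" "card (X \<inter> B) = j"
      using obtain_nsets_inter[OF K(1) B(1) j] by metis
    have "X \<subseteq> K" "finite X" "card X = a" using X by (auto simp: nsets_def)
    moreover from this have "{x \<in> X. \<sigma> x \<in> A} = X \<inter> B" by (auto simp: B_def)
    ultimately show ?thesis
      using mono[OF X(1)] card_sym_diff_image[OF A, of X \<sigma>] inj_on_subset[OF inj] X(2) by simp
  qed
  show ?thesis
  proof (rule ccontr)
    assume neg: "\<not> ?thesis"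
    have "\<not> card B \<le> t"
    proof
      assume "card B \<le> t"
      then have "a \<le> card (K - B)" using B by linarith
      then show False using val[of 0] neg by simp
    qed
    moreover have "\<not> a \<le> card B" using val[of a] neg by (auto simp: algebra_simps)
    ultimately have b: "t < card B" "card B < a" by auto
    let ?b = "card B"
    \<comment> \<open>\<open>j \<le> 2 \<le> t\<close> serves twice: \<open>?b - j\<close> is not
      truncated, and \<open>K - B\<close> has enough points left.\<close>
    have "f (int (card A) + int a - 2 * int (?b - j)) = c" if "j \<le> 2" for j
      using b B K that by (intro val) auto
    from this[of 0] this[of 1] this[of 2] triple[of "int (card A) + int a - 2 * int ?b"] b K(3)
    show False by (simp add: of_nat_diff algebra_simps)
  qed
qed

theorem theorem18:
  fixes d s :: nat
    and a t :: "nat \<Rightarrow> nat"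
    and K :: "nat \<Rightarrow> nat set"
    and C :: "nat \<Rightarrow> nat set set"
    and S :: "nat set set"
  assumes "d \<ge> 1"
    and "s \<ge> 39"
    and "S \<subseteq> cube d"
    and "\<And>i. i \<in> {1..s} \<Longrightarrow> weighted_clique (a i) (a i + t i) (K i) (C i)"
    and "disjoint_family_on K {1..s}"
    and "S = (\<Union>i\<in>{1..s}. C i)"
    and "inj_on a {1..s}"
    and "\<And>i. i \<in> {1..s} \<Longrightarrow> t i \<ge> 2"
  shows "\<not> cube_Ramsey 2 d S"
proof
  assume "cube_Ramsey 2 d S"
  then obtain n where n: "\<And>c. cube_coloring 2 n c \<Longrightarrow> has_mono_copy 2 d n S c"
    unfolding cube_Ramsey_def by blast
  define J where "J = a ` {1..s} - {1}"
  \<comment> \<open>At most one of the distinct weights equals \<open>1\<close>, so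
    \<open>38\<close> remain.\<close>
  have "card (a ` {1..s}) - card {1::nat} \<le> card J"
    unfolding J_def by (rule diff_card_le_card_Diff) simp
  then have J: "finite J" "card J \<ge> 38" "1 \<notin> J"
    using assms(2,7) by (auto simp: J_def card_image)
  obtain w where w: "\<And>m c. m \<in> {0..int n} \<Longrightarrow> \<exists>b\<in>J. both_coloured c m w b"
    using exists_pair_colouring[OF J] by blast
  define f where "f = pair_colour w"
  define col :: "nat set \<Rightarrow> nat" where "col X = (if f (int (card X)) then 1 else 2)" for X
  have "has_mono_copy 2 d n S col" by (rule n) (auto simp: cube_coloring_def col_def)
  then obtain k \<psi> where emb: "cube_embedding d n \<psi>"
    and \<psi>S: "\<psi> ` S \<subseteq> {X \<in> cube n. col X = k}"
    unfolding has_mono_copy_def contains_copy_def by blast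
  define c where "c = (k = 1)"
  obtain \<sigma> where \<sigma>: "inj_on \<sigma> {1..d}" "\<And>X. X \<subseteq> {1..d} \<Longrightarrow> \<psi> X = sym_diff (\<psi> {}) (\<sigma> ` X)"
    using cube_embedding_sym_diff[OF emb] by blast
  let ?A = "\<psi> {}"
  have A: "?A \<subseteq> {1..n}" using emb by (auto simp: cube_embedding_def cube_def)
  then have fA: "finite ?A" and cA: "card ?A \<le> n"
    using finite_subset card_mono[OF _ A] by auto
  \<comment> \<open>The colour opposite to that of the copy is requested, to contradict the clique
    of weight \<open>b\<close>.\<close>
  obtain b where b: "b \<in> J" "both_coloured (\<not> c) (int (card ?A)) w b"
    using w[of "int (card ?A)"] cA by auto
  then obtain i where i: "i \<in> {1..s}" "b = a i" by (auto simp: J_def)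
  have Ki: "finite (K i)" "card (K i) = a i + t i" "C i = nsets (K i) (a i)" "t i \<ge> 2"
    using assms(4,8) i by (auto simp: weighted_clique_def)
  have CS: "C i \<subseteq> S" using i assms(6) by blast
  have mono: "f (int (card (sym_diff ?A (\<sigma> ` X)))) = c" if "X \<in> nsets (K i) (a i)" for X
  proof -
    have "X \<in> S" using that CS Ki by blast
    then have "col (\<psi> X) = k" "X \<subseteq> {1..d}" using \<psi>S assms(3) by (auto simp: cube_def)
    then show ?thesis using \<sigma>(2)[of X] by (auto simp: col_def c_def split: if_splits)
  qed
  have "f (int (card ?A) + int (a i)) = c \<or> f (int (card ?A) - int (a i)) = c"
  \<comment> \<open>A clique of weight \<open>0\<close> is \<open>{{}}\<close> and puts no
    constraint on \<open>K i\<close>, so injectivity of \<open>\<sigma>\<close> on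
    \<open>K i\<close> is available only for positive weight.\<close>
  proof (cases "a i = 0")
    case True
    then show ?thesis using mono[of "{}"] by (simp add: nsets_def)
  next
    case False
    have "x \<in> {1..d}" if "x \<in> K i" for x
    proof -
      have "a i - 1 \<le> card (K i - {x})" using Ki that by (simp add: card_Diff_singleton)
      then obtain Y where "Y \<subseteq> K i - {x}" "card Y = a i - 1" "finite Y"
        using obtain_subset_with_card_n by blast
      then have "insert x Y \<in> nsets (K i) (a i)"
        using False that by (auto simp: nsets_def card_insert_if)
      then show ?thesis using CS Ki assms(3) by (auto simp: cube_def)
    qed
    then have "inj_on \<sigma> (K i)" using \<sigma>(1) by (meson inj_on_subset subsetI)
    with Ki fA mono show ?thesis
      by (intro mono_clique_cases[of "K i" "a i" "t i" ?A \<sigma> f c])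
        (use pair_colour_triple in \<open>auto simp: f_def\<close>)
  qed
  then show False using b i by (auto simp: both_coloured_def f_def)
qed

end
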